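(* Let $p$ be an odd prime and let $m\in\mathbb Z$ with $m\neq1$ and $p\nmid m$. Then $$\sum_{n=0}^{p-1}\frac{1}{m^n}\sum_{k=0}^n\binom{n}{k}\binom{2k}{k}\left(\frac{m-1}{4}\right)^k\equiv p+2p\,\frac{1-\left(\frac{m}{p}\right)}{m-1}\pmod{p^2}.$$
   Context: $\left(\frac{m}{p}\right)$ denotes the Legendre symbol. For rational numbers $a,b$ whose denominators are prime to $p$, $a\equiv b\pmod{p^2}$ means that $(a-b)/p^2$ is a rational number with denominator prime to $p$ (when $p\mid m-1$ one has $\left(\frac{m}{p}\right)=1$, so the right-hand side equals $p$). *)

theory Defs
  imports "HOL-Number_Theory.Number_Theory"
begin

definition denom_prime_to :: "nat \<Rightarrow> rat \<Rightarrow> bool" where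
  "denom_prime_to p x \<longleftrightarrow> coprime (snd (quotient_of x)) (int p)"

text \<open>Congruence modulo \<open>p\<^sup>2\<close> is only meant for rationals with denominators prime to \<open>p\<close>;
  this requirement on both sides is made part of the relation.\<close>

definition rat_cong_sq :: "nat \<Rightarrow> rat \<Rightarrow> rat \<Rightarrow> bool" where
  "rat_cong_sq p a b \<longleftrightarrow>
     denom_prime_to p a \<and> denom_prime_to p b \<and> denom_prime_to p ((a - b) / of_nat p ^ 2)"

end

theory Submission
  imports Defs "HOL-Computational_Algebra.Polynomial"
begin

text \<open>
  The inner sum divided by \<open>m\<^sup>n\<close> is the constant term of \<open>(1 + u (t - 2 + 1/t))\<^sup>n\<close> with
  \<open>u = (m - 1) / (4 m)\<close>. Expanding this power and summing over \<open>n < p\<close> turns the left-hand side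
  exactly into \<open>p\<close> times the sum of \<open>(p - 1 choose k) C\<^sub>k (- u)\<^sup>k\<close> over \<open>k < p\<close>, where \<open>C\<^sub>k\<close> are the
  Catalan numbers, so only the truncated Catalan series at \<open>u\<close> modulo \<open>p\<close> is needed. Its
  coefficients agree modulo \<open>p\<close> with those of \<open>(1 - (1 - 4 z)\<^bsup>(p + 1) / 2\<^esup>) / (2 z)\<close>, except that
  \<open>C\<^bsub>p - 1\<^esub> \<equiv> - 1\<close>. As \<open>1 - 4 u = 1 / m\<close>, Euler's criterion gives the value.
\<close>

section \<open>Middle coefficients of trinomial powers and the exact form of the sum\<close>

lemma coeff_linear_power_middle:
  fixes c :: "'a :: comm_semiring_1"
  shows "coeff ([:1, c:] ^ (2 * k)) k = of_nat ((2 * k) choose k) * c ^ k"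
  by (subst coeff_linear_poly_power) simp_all

text \<open>If the quadratic \<open>b (1 + c t)^2\<close> is chosen from \<open>k\<close> of the
  \<open>n\<close> factors, the others supply \<open>t^(n - k)\<close>, so what remains is the
  middle coefficient of \<open>(1 + c t)^(2 k)\<close>.\<close>

lemma coeff_trinomial_power_middle:
  fixes b c d :: "'a :: comm_ring_1"
  shows "coeff ((monom d 1 + smult b ([:1, c:] ^ 2)) ^ n) n =
    (\<Sum>k\<le>n. of_nat (n choose k) * of_nat ((2 * k) choose k) * (b * c) ^ k * d ^ (n - k))"
proof -
  have "(monom d 1 + smult b ([:1, c:] ^ 2)) ^ n =
    (\<Sum>k\<le>n. of_nat (n choose k) * (smult b ([:1, c:] ^ 2)) ^ k * monom d 1 ^ (n - k))"
    by (subst add.commute) (simp add: binomial_ring)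
  also have "\<dots> = (\<Sum>k\<le>n. monom (of_nat (n choose k) * b ^ k * d ^ (n - k)) (n - k) * [:1, c:] ^ (2 * k))"
    by (intro sum.cong refl)
      (simp add: smult_power monom_power power_mult [symmetric] of_nat_poly
        smult_monom [symmetric] ac_simps del: smult_monom)
  also have "coeff \<dots> n =
    (\<Sum>k\<le>n. of_nat (n choose k) * of_nat ((2 * k) choose k) * (b * c) ^ k * d ^ (n - k))"
    unfolding coeff_sum
  proof (intro sum.cong refl)
    fix k assume "k \<in> {..n}"
    then have "coeff (monom (of_nat (n choose k) * b ^ k * d ^ (n - k)) (n - k) * [:1, c:] ^ (2 * k)) n =
        of_nat (n choose k) * b ^ k * d ^ (n - k) * (of_nat ((2 * k) choose k) * c ^ k)"
      by (simp add: coeff_monom_mult coeff_linear_power_middle)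
    then show "coeff (monom (of_nat (n choose k) * b ^ k * d ^ (n - k)) (n - k) * [:1, c:] ^ (2 * k)) n =
        of_nat (n choose k) * of_nat ((2 * k) choose k) * (b * c) ^ k * d ^ (n - k)"
      by (simp only: power_mult_distrib ac_simps)
  qed
  finally show ?thesis .
qed

lemma central_binomial_transform:
  fixes a :: "'a :: comm_ring_1"
  shows "(\<Sum>k\<le>n. of_nat (n choose k) * of_nat ((2 * k) choose k) * a ^ k) =
    (\<Sum>k\<le>n. of_nat (n choose k) * of_nat ((2 * k) choose k) * (- a) ^ k * (1 + 4 * a) ^ (n - k))"
proof -
  \<comment> \<open>\<open>t + a (1 + t)\<^sup>2 = (1 + 4 a) t + a (1 - t)\<^sup>2\<close>\<close>
  have "monom 1 1 + smult a ([:1, 1:] ^ 2) = monom (1 + 4 * a) 1 + smult a ([:1, - 1:] ^ 2)"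
    by (simp add: power2_eq_square monom_altdef algebra_simps)
  from arg_cong [OF this, of "\<lambda>q. coeff (q ^ n) n"] show ?thesis
    unfolding coeff_trinomial_power_middle by simp
qed

text \<open>For \<open>a = (m - 1) / 4\<close> the transform has \<open>1 + 4 a = m\<close>, so
  division by \<open>m^n\<close> leaves \<open>n\<close> only in the factor
  \<open>n choose k\<close>. The outer sum can then be carried out first.\<close>

lemma sum_scaled_central_binomial_transform:
  fixes m :: "'a :: field_char_0"
  assumes "m \<noteq> 0"
  shows "(\<Sum>n<N. 1 / m ^ n *
      (\<Sum>k\<le>n. of_nat (n choose k) * of_nat ((2 * k) choose k) * ((m - 1) / 4) ^ k)) =
    (\<Sum>k<N. of_nat (N choose Suc k) * of_nat ((2 * k) choose k) * ((1 - m) / (4 * m)) ^ k)"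
proof -
  define c where "c k = of_nat ((2 * k) choose k) * ((1 - m) / (4 * m)) ^ k" for k
  have m: "1 + 4 * ((m - 1) / 4) = m"
    by (simp del: right_diff_distrib_numeral)
  have "1 / m ^ n *
      (\<Sum>k\<le>n. of_nat (n choose k) * of_nat ((2 * k) choose k) * ((m - 1) / 4) ^ k) =
      (\<Sum>k\<le>n. of_nat (n choose k) * c k)" for n
  proof -
    have *: "1 / m ^ n * (of_nat (n choose k) * of_nat ((2 * k) choose k) * (- ((m - 1) / 4)) ^ k *
        m ^ (n - k)) = of_nat (n choose k) * c k" if "k \<le> n" for k
    proof -
      have "m ^ n = m ^ k * m ^ (n - k)"
        using that by (simp flip: power_add)
      moreover have "- ((m - 1) / 4) = (1 - m) / (4 * m) * m"
        using assms by (simp add: field_simps)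
      then have "(- ((m - 1) / 4)) ^ k = ((1 - m) / (4 * m)) ^ k * m ^ k"
        by (simp only: power_mult_distrib)
      ultimately show ?thesis
        using assms by (simp add: c_def)
    qed
    show ?thesis
      unfolding central_binomial_transform m sum_distrib_left by (intro sum.cong refl *) simp
  qed
  \<comment> \<open>Since \<open>n choose k\<close> vanishes for \<open>k > n\<close>, the inner
    range can be made independent of \<open>n\<close>, which permits the exchange of sums.\<close>
  moreover have "(\<Sum>k\<le>n. of_nat (n choose k) * c k) = (\<Sum>k<N. of_nat (n choose k) * c k)"
    if "n < N" for n
    using that by (intro sum.mono_neutral_left) auto
  ultimately have "(\<Sum>n<N. 1 / m ^ n *
      (\<Sum>k\<le>n. of_nat (n choose k) * of_nat ((2 * k) choose k) * ((m - 1) / 4) ^ k)) =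
      (\<Sum>n<N. \<Sum>k<N. of_nat (n choose k) * c k)"
    by simp
  also have "\<dots> = (\<Sum>k<N. of_nat (\<Sum>n<N. n choose k) * c k)"
    by (subst sum.swap) (simp add: sum_distrib_right)
  also have "\<dots> = (\<Sum>k<N. of_nat (N choose Suc k) * c k)"
  proof -
    \<comment> \<open>Hockey-stick identity; \<open>N = 0\<close> is the empty sum.\<close>
    have "(\<Sum>n<N. n choose k) = N choose Suc k" for k
      by (cases N) (simp_all add: lessThan_Suc_atMost sum_choose_upper)
    then show ?thesis by simp
  qed
  finally show ?thesis
    by (simp add: c_def mult.assoc)
qed

section \<open>Catalan numbers\<close>

text \<open>The difference form makes integrality evident and allows reduction modulo
  \<open>p\<close> at \<open>k = p - 1\<close>, where the quotient form would divide by
  \<open>p\<close>.\<close>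

definition catalan :: "nat \<Rightarrow> int" where
  "catalan k = int ((2 * k) choose k) - int ((2 * k) choose Suc k)"

lemma Suc_times_catalan: "int (Suc k) * catalan k = int ((2 * k) choose k)"
proof -
  have "Suc k * ((2 * k) choose Suc k) = k * ((2 * k) choose k)"
    using Suc_times_binomial [of k "2 * k"] binomial_Suc_Suc [of "2 * k" k]
    by (simp add: algebra_simps)
  then have "int (Suc k) * int ((2 * k) choose Suc k) = int k * int ((2 * k) choose k)"
    by (metis of_nat_mult)
  then show ?thesis
    by (simp add: catalan_def algebra_simps)
qed

lemma Suc_times_central_binomial:
  "Suc k * ((2 * Suc k) choose Suc k) = (4 * k + 2) * ((2 * k) choose k)"
proof -
  have 1: "(2 * Suc k) choose Suc k = 2 * (Suc (2 * k) choose k)"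
    using binomial_symmetric [of k "Suc (2 * k)"] by (simp add: numeral_2_eq_2)
  have 2: "Suc k * (Suc (2 * k) choose Suc k) = Suc (2 * k) * ((2 * k) choose k)"
    by (rule Suc_times_binomial)
  have 3: "Suc (2 * k) choose Suc k = Suc (2 * k) choose k"
    using binomial_symmetric [of k "Suc (2 * k)"] by simp
  show ?thesis
    using 1 2 3 by (simp add: algebra_simps)
qed

lemma catalan_0 [simp]: "catalan 0 = 1"
  by (simp add: catalan_def)

lemma catalan_Suc: "int (k + 2) * catalan (Suc k) = int (4 * k + 2) * catalan k"
proof -
  \<comment> \<open>Multiplying by \<open>k + 1\<close> turns both sides into central binomials; the
    factor is cancelled at the end.\<close>
  have "int (Suc k) * (int (k + 2) * catalan (Suc k)) = int (Suc k * ((2 * Suc k) choose Suc k))"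
    using Suc_times_catalan [of "Suc k"]
    by (simp only: of_nat_mult) simp
  also have "\<dots> = int (4 * k + 2) * (int (Suc k) * catalan k)"
    by (simp only: Suc_times_central_binomial Suc_times_catalan of_nat_mult)
  finally show ?thesis
    by (simp del: of_nat_Suc add: mult.left_commute)
qed

text \<open>For \<open>n = p\<close> this extracts an exact factor \<open>p\<close> from every term,
  reducing a congruence modulo \<open>p^2\<close> to one modulo \<open>p\<close>.\<close>

lemma times_binomial_catalan:
  assumes "0 < n"
  shows "int (n choose Suc k) * int ((2 * k) choose k) = int n * (int ((n - 1) choose k) * catalan k)"
proof -
  have "int (Suc k) * int (n choose Suc k) = int n * int ((n - 1) choose k)"
    using Suc_times_binomial [of k "n - 1"] assms by (metis Suc_diff_1 of_nat_mult)
  then show ?thesis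
    by (metis Suc_times_catalan mult.assoc mult.commute)
qed

section \<open>Binomials and Catalan numbers modulo p\<close>

lemma binomial_prime_minus_one_cong:
  assumes "prime p" "k < p"
  shows "[int ((p - 1) choose k) = (- 1) ^ k] (mod int p)"
  using assms(2)
proof (induction k)
  case (Suc k)
  \<comment> \<open>Neighbours in row \<open>p - 1\<close> add up to an inner entry of row
    \<open>p\<close>, hence to \<open>0\<close> modulo \<open>p\<close>, so the sign
    alternates.\<close>
  have "p choose Suc k = ((p - 1) choose k) + ((p - 1) choose Suc k)"
    using assms(1) prime_gt_0_nat binomial_Suc_Suc [of "p - 1" k] by simp
  then have "int p dvd int ((p - 1) choose k) + int ((p - 1) choose Suc k)"
    using dvd_choose_prime [OF Suc.prems _ _ assms(1)] Suc.prems
    by (metis Zero_not_Suc int_dvd_int_iff nat_neq_iff of_nat_add assms(1) not_prime_0)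
  then have "[int ((p - 1) choose Suc k) = - int ((p - 1) choose k)] (mod int p)"
    by (simp add: cong_iff_dvd_diff add.commute)
  also have "[- int ((p - 1) choose k) = - ((- 1) ^ k)] (mod int p)"
    using Suc by (simp add: cong_minus_minus_iff)
  finally show ?case by simp
qed simp

lemma catalan_prime_minus_one_cong:
  assumes "prime p" "odd p"
  shows "[catalan (p - 1) = - 1] (mod int p)"
proof -
  have p: "p \<ge> 3"
    using assms by (metis One_nat_def even_numeral le_antisym nat_le_linear not_less_eq_eq
        numeral_3_eq_3 one_add_one plus_1_eq_Suc prime_ge_2_nat)
  have "int p dvd int ((2 * (p - 1)) choose (p - 1))"
    using Suc_times_catalan [of "p - 1"] p by (metis Suc_diff_1 dvd_triv_left assms(1) prime_gt_0_nat)
  moreover have "[(2 * (p - 1)) choose p = 1] (mod p)"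
  proof -
    \<comment> \<open>Vandermonde for \<open>2 p - 2 = p + (p - 2)\<close>: inner \<open>k\<close>
      vanish modulo \<open>p\<close>, and \<open>k = 0\<close> gives
      \<open>(p - 2) choose p = 0\<close>, so only \<open>k = p\<close> survives.\<close>
    have "(2 * (p - 1)) choose p = (\<Sum>k\<le>p. (p choose k) * ((p - 2) choose (p - k)))"
      using p by (simp add: vandermonde) (simp add: numeral_2_eq_2)
    also have "[\<dots> = (\<Sum>k\<le>p. if k = p then 1 else 0)] (mod p)"
    proof (intro cong_sum)
      fix k assume k: "k \<in> {..p}"
      consider "k = 0" | "0 < k" "k < p" | "k = p"
        using k by fastforce
      then show "[(p choose k) * ((p - 2) choose (p - k)) = (if k = p then 1 else 0)] (mod p)"
      proof cases
        case 2
        then have "p dvd p choose k"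
          using dvd_choose_prime assms(1) by (metis less_numeral_extra(3) nat_neq_iff not_prime_0)
        then show ?thesis using 2 by (simp add: cong_0_iff)
      qed (use p in \<open>simp_all add: binomial_eq_0\<close>)
    qed
    finally show ?thesis by simp
  qed
  then have "[int ((2 * (p - 1)) choose p) = 1] (mod int p)"
    by (metis cong_int_iff of_nat_1)
  ultimately have "[int ((2 * (p - 1)) choose (p - 1)) - int ((2 * (p - 1)) choose p) = 0 - 1] (mod int p)"
    by (intro cong_diff) (simp_all add: cong_0_iff)
  then show ?thesis
    using p by (simp add: catalan_def)
qed

text \<open>The exponent \<open>(p + 1) / 2\<close> is \<open>1 / 2\<close> modulo \<open>p\<close>,
  so the coefficients of \<open>(1 - 4 z)^((p + 1) / 2)\<close> obey the Catalan recurrence modulo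
  \<open>p\<close>. The induction stops before \<open>k = p - 1\<close>, where the leading factor of
  the recurrence would be \<open>p\<close>.\<close>

lemma binomial_half_cong_catalan:
  assumes "prime p" "odd p" "k < p - 1"
  shows "[int ((Suc p div 2) choose Suc k) * (- 4) ^ Suc k = - 2 * catalan k] (mod int p)"
  using assms(3)
proof (induction k)
  case 0
  have "int (Suc p div 2) * 2 = int p + 1"
    using assms(2) by (metis Suc_eq_plus1 dvd_div_mult_self even_Suc of_nat_1 of_nat_add of_nat_mult of_nat_numeral)
  then have "int (Suc p div 2) * (- 4) - (- 2) = int p * (- 2)"
    by simp
  then show ?case
    by (simp only: cong_iff_dvd_diff catalan_0) (simp del: div_Suc)
next
  case (Suc k)
  define h where "h = Suc p div 2"
  define b where "b j = int (h choose j) * (- 4) ^ j" for j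
  have h: "2 * int h = int p + 1"
    using assms(2) unfolding h_def
    by (metis Suc_eq_plus1 dvd_mult_div_cancel even_Suc of_nat_1 of_nat_add of_nat_mult of_nat_numeral)
  have "int h * int (h choose Suc k) =
      int (Suc k) * int (h choose Suc k) + int (Suc (Suc k)) * int (h choose Suc (Suc k))"
  proof -
    have "int (Suc (Suc k)) * int (Suc h choose Suc (Suc k)) = int (Suc h) * int (h choose Suc k)"
      using Suc_times_binomial [of "Suc k" h] by (metis of_nat_mult)
    then show ?thesis
      by (simp add: algebra_simps)
  qed
  \<comment> \<open>The subtraction is taken in the integers because \<open>Suc k\<close> may exceed
    \<open>h\<close>.\<close>
  then have step: "int (k + 2) * int (h choose Suc (Suc k)) = (int h - int (Suc k)) * int (h choose Suc k)"
    by (simp add: left_diff_distrib)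
  have "int (k + 2) * b (Suc (Suc k)) =
      (int (k + 2) * int (h choose Suc (Suc k))) * (- 4) * (- 4) ^ Suc k"
    by (simp only: b_def power_Suc mult_ac)
  also have "\<dots> = (int h - int (Suc k)) * (- 4) * b (Suc k)"
    unfolding step by (simp only: b_def mult_ac)
  also have "(int h - int (Suc k)) * (- 4) = int (4 * k + 2) - 2 * int p"
    using h by simp
  finally have "int (k + 2) * b (Suc (Suc k)) = (int (4 * k + 2) - 2 * int p) * b (Suc k)" .
  then have "int (k + 2) * b (Suc (Suc k)) - int (4 * k + 2) * b (Suc k) = int p * (- 2 * b (Suc k))"
    by (simp only: left_diff_distrib)
  then have "[int (k + 2) * b (Suc (Suc k)) = int (4 * k + 2) * b (Suc k)] (mod int p)"
    unfolding cong_iff_dvd_diff by (metis dvd_triv_left)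
  also have "[int (4 * k + 2) * b (Suc k) = int (4 * k + 2) * (- 2 * catalan k)] (mod int p)"
    using Suc unfolding b_def h_def by (intro cong_scalar_left) simp
  also have "int (4 * k + 2) * (- 2 * catalan k) = int (k + 2) * (- 2 * catalan (Suc k))"
    by (simp only: mult.left_commute [of _ "- 2"] catalan_Suc)
  finally have "[int (k + 2) * b (Suc (Suc k)) = int (k + 2) * (- 2 * catalan (Suc k))] (mod int p)" .
  moreover have "coprime (int (k + 2)) (int p)"
    using Suc.prems assms(1) by (simp only: coprime_int_iff)
      (metis add_2_eq_Suc' coprime_commute less_diff_conv nat_dvd_not_less prime_imp_coprime_nat zero_less_Suc Suc_eq_plus1)
  ultimately show ?case
    unfolding b_def h_def by (metis cong_mult_lcancel)
qed

section \<open>Euler's criterion and the truncated Catalan series\<close>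

lemma Legendre_mult_self:
  assumes "\<not> p dvd a"
  shows "Legendre a p * Legendre a p = 1"
  using assms by (simp add: Legendre_def cong_0_iff)

text \<open>Squaring Euler's criterion yields Fermat's little theorem:
  \<open>z^p = z (z^h)^2\<close> for \<open>p = 2 h + 1\<close>, and the symbol squares to
  \<open>1\<close> when \<open>p\<close> does not divide \<open>z\<close>.\<close>

lemma int_power_prime_cong:
  fixes z :: int
  assumes "prime p" "odd p"
  shows "[z ^ p = z] (mod int p)"
proof (cases "int p dvd z")
  case True
  moreover have "int p dvd z ^ p"
    using True assms(1) by (meson dvd_power dvd_trans prime_gt_0_nat)
  ultimately show ?thesis
    by (simp add: cong_iff_dvd_diff)
next
  case False
  define h where "h = (p - 1) div 2"
  have "p > 2"
    using assms by (metis even_numeral le_neq_implies_less prime_ge_2_nat)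
  then have L: "[Legendre z (int p) = z ^ h] (mod int p)"
    unfolding h_def by (rule euler_criterion [OF assms(1)])
  have "p = Suc (h + h)"
    using assms(2) by (auto simp: h_def elim!: oddE)
  then have "z ^ p = z * (z ^ h * z ^ h)"
    by (simp add: power_add)
  also have "[\<dots> = z * (Legendre z (int p) * Legendre z (int p))] (mod int p)"
    by (intro cong_mult cong_refl cong_sym [OF L])
  finally show ?thesis
    by (simp add: Legendre_mult_self [OF False])
qed

lemma catalan_sum_cong:
  fixes z :: int
  assumes "prime p" "odd p"
  shows "[2 * z * (\<Sum>k<p. catalan k * z ^ k) = 1 - 2 * z - (1 - 4 * z) ^ (Suc p div 2)] (mod int p)"
proof -
  define h where "h = Suc p div 2"
  have p: "p \<ge> 3"
    using assms by (metis One_nat_def even_numeral le_antisym nat_le_linear not_less_eq_eq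
        numeral_3_eq_3 one_add_one plus_1_eq_Suc prime_ge_2_nat)
  then have "h \<le> p - 1"
    by (simp add: h_def)
  have "(1 - 4 * z) ^ h = (\<Sum>j\<le>h. int (h choose j) * (- 4 * z) ^ j)"
    using binomial_ring [of "- 4 * z" 1 h] by simp
  also have "\<dots> = (\<Sum>j\<le>p - 1. int (h choose j) * (- 4 * z) ^ j)"
    using \<open>h \<le> p - 1\<close> by (intro sum.mono_neutral_left) auto
  also have "\<dots> = (\<Sum>j<Suc (p - 1). int (h choose j) * (- 4 * z) ^ j)"
    by (simp only: lessThan_Suc_atMost)
  also have "\<dots> = 1 + (\<Sum>k<p - 1. int (h choose Suc k) * (- 4) ^ Suc k * z ^ Suc k)"
    unfolding sum.lessThan_Suc_shift by (simp only: power_mult_distrib) (simp add: mult.assoc)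
  also have "[\<dots> = 1 + (\<Sum>k<p - 1. - 2 * catalan k * z ^ Suc k)] (mod int p)"
    unfolding h_def using assms
    by (intro cong_add cong_refl cong_sum cong_mult binomial_half_cong_catalan) simp_all
  finally have 1: "[(1 - 4 * z) ^ h = 1 + (\<Sum>k<p - 1. - 2 * catalan k * z ^ Suc k)] (mod int p)" .
  have "[z ^ p = z] (mod int p)"
    using assms by (intro int_power_prime_cong)
  \<comment> \<open>The exceptional last term, not covered by the binomial coefficients, is the
    source of \<open>- 2 * z\<close> in the result.\<close>
  then have 2: "[2 * catalan (p - 1) * z ^ p = 2 * (- 1) * z] (mod int p)"
    using assms by (intro cong_mult cong_refl catalan_prime_minus_one_cong)
  have "2 * z * (\<Sum>k<Suc (p - 1). catalan k * z ^ k) =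
      1 - (1 + (\<Sum>k<p - 1. - 2 * catalan k * z ^ Suc k)) + 2 * catalan (p - 1) * z ^ Suc (p - 1)"
    by (simp add: sum_distrib_left sum_negf algebra_simps)
  also have "Suc (p - 1) = p"
    using p by simp
  also have "[1 - (1 + (\<Sum>k<p - 1. - 2 * catalan k * z ^ Suc k)) + 2 * catalan (p - 1) * z ^ p =
      1 - (1 - 4 * z) ^ h + 2 * (- 1) * z] (mod int p)"
    by (intro cong_add cong_diff cong_refl 2 cong_sym [OF 1])
  also have "1 - (1 - 4 * z) ^ h + 2 * (- 1) * z = 1 - 2 * z - (1 - 4 * z) ^ h"
    by simp
  finally show ?thesis
    unfolding h_def .
qed

text \<open>Here \<open>w\<close> plays the role of \<open>1 / (4 m)\<close>, so
  \<open>(m - 1) * w\<close> represents \<open>u\<close> modulo \<open>p\<close>. The factor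
  \<open>m - 1\<close> stays on the left because it may be divisible by \<open>p\<close>.\<close>

lemma catalan_sum_Legendre_cong:
  fixes m w :: int
  assumes "prime p" "odd p" and inv: "[4 * m * w = 1] (mod int p)"
  shows "[(m - 1) * (\<Sum>k<p. catalan k * ((m - 1) * w) ^ k) = m + 1 - 2 * Legendre m (int p)] (mod int p)"
proof -
  define S where "S = (\<Sum>k<p. catalan k * ((m - 1) * w) ^ k)"
  define q where "q = 1 - 4 * ((m - 1) * w)"
  define h where "h = (p - 1) div 2"
  define L where "L = Legendre m (int p)"
  have p: "p > 2"
    using assms by (metis even_numeral le_neq_implies_less prime_ge_2_nat)
  have mq: "[m * q = 1] (mod int p)"
  proof -
    have "m * q - 1 = (m - 1) * (1 - 4 * m * w)"
      by (simp add: q_def algebra_simps)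
    moreover have "int p dvd 1 - 4 * m * w"
      using inv by (metis cong_iff_dvd_diff cong_sym)
    ultimately show ?thesis
      by (simp add: cong_iff_dvd_diff)
  qed
  have L: "[L = m ^ h] (mod int p)"
    unfolding L_def h_def using euler_criterion [OF assms(1) p] .
  have "[m \<noteq> 0] (mod int p)"
  proof
    assume "[m = 0] (mod int p)"
    then have "[4 * m * w = 4 * 0 * w] (mod int p)"
      by (intro cong_mult cong_refl)
    then have "[1 = 0] (mod int p)"
      using inv by (simp add: cong_def)
    then show False
      using p by (simp add: cong_def)
  qed
  then have LL: "L * L = 1"
    by (simp add: L_def Legendre_mult_self cong_0_iff)
  \<comment> \<open>As \<open>q\<close> is inverse to \<open>m\<close>, \<open>q^h\<close> is
    inverse to \<open>m^h\<close>, that is, to \<open>L\<close>; and \<open>L\<close> is its own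
    inverse.\<close>
  have "[q ^ h = L * L * q ^ h] (mod int p)"
    by (simp add: LL)
  also have "[L * L * q ^ h = L * m ^ h * q ^ h] (mod int p)"
    by (intro cong_mult cong_refl L)
  also have "L * m ^ h * q ^ h = L * (m * q) ^ h"
    by (simp add: power_mult_distrib)
  also have "[L * (m * q) ^ h = L * 1 ^ h] (mod int p)"
    by (intro cong_mult cong_refl cong_pow mq)
  finally have qh: "[q ^ h = L] (mod int p)"
    by simp
  have "Suc p div 2 = Suc h"
    using p assms(2) by (auto simp: h_def elim: oddE)
  then have main: "[2 * ((m - 1) * w) * S = 1 - 2 * ((m - 1) * w) - q * q ^ h] (mod int p)"
    using catalan_sum_cong [OF assms(1,2), of "(m - 1) * w"] by (simp add: S_def q_def)
  \<comment> \<open>Inserting \<open>4 * m * w\<close> creates the factor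
    \<open>2 * ((m - 1) * w)\<close> needed for \<open>main\<close> without any division.\<close>
  have "[(m - 1) * S = (m - 1) * (4 * m * w) * S] (mod int p)"
    using cong_mult [OF cong_mult [OF cong_refl cong_sym [OF inv]] cong_refl, of "m - 1" S] by simp
  also have "(m - 1) * (4 * m * w) * S = 2 * m * (2 * ((m - 1) * w) * S)"
    by simp
  also have "[\<dots> = 2 * m * (1 - 2 * ((m - 1) * w) - q * q ^ h)] (mod int p)"
    by (intro cong_scalar_left main)
  also have "2 * m * (1 - 2 * ((m - 1) * w) - q * q ^ h) =
      2 * m - (m - 1) * (4 * m * w) - 2 * (m * q) * q ^ h"
    by (simp add: algebra_simps)
  also have "[\<dots> = 2 * m - (m - 1) * 1 - 2 * 1 * L] (mod int p)"
    by (intro cong_diff cong_mult cong_refl inv mq qh)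
  finally show ?thesis
    by (simp add: S_def L_def algebra_simps)
qed

section \<open>Denominators prime to p and the final congruence\<close>

text \<open>In lowest terms \<open>x = c / d\<close> gives \<open>c * b = a * d\<close>, so
  \<open>d\<close> divides \<open>b\<close> by coprimality. It thus suffices to exhibit any
  multiplier prime to \<open>p\<close> that makes \<open>x\<close> an integer.\<close>

lemma denom_prime_toI:
  assumes "prime p" "\<not> int p dvd b" "x * of_int b = of_int a"
  shows "denom_prime_to p x"
proof -
  obtain c d where cd: "quotient_of x = (c, d)"
    by force
  have d: "d > 0" "coprime c d"
    using quotient_of_denom_pos [OF cd] quotient_of_coprime [OF cd] by auto
  have "x = of_int c / of_int d"
    using quotient_of_div [OF cd] .
  then have "of_int (c * b) = (of_int (a * d) :: rat)"
    using assms(3) [symmetric] d by simp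
  then have "d dvd c * b"
    by (metis dvd_triv_right of_int_eq_iff)
  then have "d dvd b"
    using d by (simp add: coprime_commute coprime_dvd_mult_right_iff)
  then have "\<not> int p dvd d"
    using assms(2) dvd_trans by blast
  then have "coprime (int p) d"
    using assms(1) by (intro prime_imp_coprime) simp_all
  then show ?thesis
    by (simp add: denom_prime_to_def cd coprime_commute)
qed

theorem theorem1p3:
  fixes p :: nat and m :: int
  assumes "prime p" and "odd p" and "m \<noteq> 1" and "\<not> int p dvd m"
  shows "rat_cong_sq p
    (\<Sum>n = 0..p - 1. 1 / (of_int m :: rat) ^ n *
       (\<Sum>k = 0..n. of_nat (n choose k) * of_nat ((2 * k) choose k) * ((of_int m - 1) / 4) ^ k))
    (of_nat p + 2 * of_nat p * ((1 - of_int (Legendre m (int p))) / (of_int m - 1)))"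
proof -
  \<comment> \<open>\<open>D\<close> clears the denominators of all powers of
    \<open>(1 - m) / (4 * m)\<close> with exponent below \<open>p\<close>; \<open>N\<close> is the
    integer left after also taking out \<open>p\<close>.\<close>
  define D where "D = (4 * m) ^ (p - 1)"
  define L where "L = Legendre m (int p)"
  define N where "N = (\<Sum>k<p. int ((p - 1) choose k) * catalan k * (1 - m) ^ k * (4 * m) ^ (p - 1 - k))"
  define S where "S = (\<Sum>n = 0..p - 1. 1 / (of_int m :: rat) ^ n *
       (\<Sum>k = 0..n. of_nat (n choose k) * of_nat ((2 * k) choose k) * ((of_int m - 1) / 4) ^ k))"
  define R where "R = of_nat p + 2 * of_nat p * ((1 - of_int L) / (of_int m - 1 :: rat))"
  have p: "p > 2"
    using assms by (metis even_numeral le_neq_implies_less prime_ge_2_nat)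
  have pp: "prime (int p)"
    using assms(1) by simp
  have "\<not> int p dvd 2"
    using p by (auto dest: zdvd_imp_le)
  then have "\<not> int p dvd 2 ^ 2"
    using pp by (metis prime_dvd_power)
  then have "\<not> int p dvd 4"
    by simp
  then have p4m: "\<not> int p dvd 4 * m"
    using assms(4) pp by (simp add: prime_dvd_mult_iff)
  then have pD: "\<not> int p dvd D"
    using pp unfolding D_def by (metis prime_dvd_power)
  have m0: "m \<noteq> 0"
    using assms(4) by auto
  have SD: "S * of_int D = of_int (int p * N)"
  proof -
    have "S = (\<Sum>k<p. of_nat (p choose Suc k) * of_nat ((2 * k) choose k) * ((1 - of_int m) / (4 * of_int m)) ^ k)"
      using sum_scaled_central_binomial_transform [of "of_int m :: rat" p] m0 p
      by (simp add: S_def atLeast0AtMost lessThan_Suc_atMost [symmetric])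
    also have "\<dots> * of_int D = (\<Sum>k<p. of_int (int p * (int ((p - 1) choose k) * catalan k * (1 - m) ^ k * (4 * m) ^ (p - 1 - k))))"
      unfolding sum_distrib_right
    proof (intro sum.cong refl)
      fix k assume k: "k \<in> {..<p}"
      have "of_int (int (p choose Suc k) * int ((2 * k) choose k)) =
          (of_int (int p * (int ((p - 1) choose k) * catalan k)) :: rat)"
        using p by (subst times_binomial_catalan) auto
      moreover have "D = (4 * m) ^ k * (4 * m) ^ (p - 1 - k)"
        using k unfolding D_def by (subst power_add [symmetric]) simp
      ultimately show "of_nat (p choose Suc k) * of_nat ((2 * k) choose k) * ((1 - of_int m) / (4 * of_int m)) ^ k * of_int D =
          (of_int (int p * (int ((p - 1) choose k) * catalan k * (1 - m) ^ k * (4 * m) ^ (p - 1 - k))) :: rat)"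
        using m0 by (simp add: power_divide)
    qed
    finally show ?thesis
      by (simp add: N_def sum_distrib_left)
  qed
  obtain w where w: "[4 * m * w = 1] (mod int p)"
    using p4m pp by (metis cong_solve_coprime_int coprime_commute prime_imp_coprime)
  \<comment> \<open>The sign of \<open>(p - 1) choose k\<close> modulo \<open>p\<close> turns
    \<open>(1 - m)^k\<close> into \<open>(m - 1)^k\<close>, and \<open>(4 * m)^(p - 1 - k)\<close>
    is congruent to \<open>D * w^k\<close>.\<close>
  have N: "[N = D * (\<Sum>k<p. catalan k * ((m - 1) * w) ^ k)] (mod int p)"
    unfolding N_def sum_distrib_left
  proof (intro cong_sum)
    fix k assume k: "k \<in> {..<p}"
    have "[int ((p - 1) choose k) * catalan k * (1 - m) ^ k * (4 * m) ^ (p - 1 - k) =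
        (- 1) ^ k * catalan k * (1 - m) ^ k * (4 * m) ^ (p - 1 - k)] (mod int p)"
      using k assms(1) by (intro cong_mult cong_refl binomial_prime_minus_one_cong) auto
    also have "(- 1) ^ k * catalan k * (1 - m) ^ k * (4 * m) ^ (p - 1 - k) =
        catalan k * (m - 1) ^ k * (4 * m) ^ (p - 1 - k) * 1 ^ k"
      using power_mult_distrib [of "- 1" "1 - m" k] by simp
    also have "[\<dots> = catalan k * (m - 1) ^ k * (4 * m) ^ (p - 1 - k) * (4 * m * w) ^ k] (mod int p)"
      by (intro cong_mult cong_refl cong_pow cong_sym [OF w])
    also have "catalan k * (m - 1) ^ k * (4 * m) ^ (p - 1 - k) * (4 * m * w) ^ k =
        catalan k * (m - 1) ^ k * ((4 * m) ^ (p - 1 - k) * (4 * m) ^ k) * w ^ k"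
      by (simp only: power_mult_distrib ac_simps)
    also have "(4 * m) ^ (p - 1 - k) * (4 * m) ^ k = D"
      using k unfolding D_def by (subst power_add [symmetric]) simp
    also have "catalan k * (m - 1) ^ k * D * w ^ k = D * (catalan k * ((m - 1) * w) ^ k)"
      by (simp only: power_mult_distrib ac_simps)
    finally show "[int ((p - 1) choose k) * catalan k * (1 - m) ^ k * (4 * m) ^ (p - 1 - k) =
        D * (catalan k * ((m - 1) * w) ^ k)] (mod int p)" .
  qed
  have "denom_prime_to p S"
    using denom_prime_toI [OF assms(1) pD SD] .
  moreover have "denom_prime_to p R \<and> denom_prime_to p ((S - R) / of_nat p ^ 2)"
  \<comment> \<open>If \<open>p\<close> divides \<open>m - 1\<close>, that factor cannot be
    cancelled modulo \<open>p\<close>; but then \<open>L = 1\<close>, so \<open>R = p\<close>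
    exactly, and the series reduces to its term \<open>k = 0\<close>.\<close>
  proof (cases "int p dvd m - 1")
    case True
    have "L = 1"
    proof -
      have "[1\<^sup>2 = m] (mod int p)"
        using True by (metis cong_iff_dvd_diff cong_sym power_one)
      then have "QuadRes (int p) m"
        unfolding QuadRes_def by blast
      then show ?thesis
        using assms(4) by (simp add: L_def Legendre_def cong_0_iff)
    qed
    then have R: "R = of_int (int p)"
      by (simp add: R_def)
    have "[(\<Sum>k<p. catalan k * ((m - 1) * w) ^ k) = (\<Sum>k<p. if k = 0 then 1 else 0)] (mod int p)"
    proof (intro cong_sum)
      fix k
      show "[catalan k * ((m - 1) * w) ^ k = (if k = 0 then 1 else 0)] (mod int p)"
        using True by (cases k) (auto simp: cong_0_iff)
    qed
    then have "[(\<Sum>k<p. catalan k * ((m - 1) * w) ^ k) = 1] (mod int p)"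
      using p by simp
    then have "[N = D] (mod int p)"
      using N by (metis cong_scalar_left cong_trans mult.right_neutral)
    then obtain c where c: "N - D = int p * c"
      by (auto simp: cong_iff_dvd_diff)
    \<comment> \<open>One \<open>p\<close> comes from \<open>S\<close> and \<open>R\<close>, the
      second from \<open>N - D\<close>.\<close>
    have "(S - R) * of_int D = of_int (int p * (N - D))"
      by (simp add: left_diff_distrib SD R algebra_simps)
    then have "(S - R) / of_nat p ^ 2 * of_int D = of_int c"
      using p by (simp add: c field_simps power2_eq_square)
    then show ?thesis
      using denom_prime_toI [OF assms(1) pD] denom_prime_toI [OF assms(1), of 1 R "int p"] R p by auto
  next
    case False
    then have pE: "\<not> int p dvd D * (m - 1)"
      using pD pp by (simp add: prime_dvd_mult_iff)
    have m1: "of_int m - 1 \<noteq> (0 :: rat)"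
      using assms(3) by simp
    have R: "R * of_int (m - 1) = of_int (int p * (m + 1 - 2 * L))"
      using m1 by (simp add: R_def field_simps)
    have "[(m - 1) * N = D * ((m - 1) * (\<Sum>k<p. catalan k * ((m - 1) * w) ^ k))] (mod int p)"
      using cong_scalar_left [OF N, of "m - 1"] by (simp add: mult.left_commute)
    also have "[D * ((m - 1) * (\<Sum>k<p. catalan k * ((m - 1) * w) ^ k)) = D * (m + 1 - 2 * L)] (mod int p)"
      unfolding L_def by (intro cong_scalar_left catalan_sum_Legendre_cong assms w)
    finally obtain c where c: "(m - 1) * N - D * (m + 1 - 2 * L) = int p * c"
      by (auto simp: cong_iff_dvd_diff)
    \<comment> \<open>\<open>D\<close> clears \<open>S\<close> and \<open>m - 1\<close> clears
      \<open>R\<close>; their product is prime to \<open>p\<close> in this case and serves as the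
      multiplier for the difference.\<close>
    have "(S - R) * of_int (D * (m - 1)) = S * of_int D * of_int (m - 1) - R * of_int (m - 1) * of_int D"
      by (simp add: algebra_simps)
    also have "\<dots> = of_int (int p * ((m - 1) * N - D * (m + 1 - 2 * L)))"
      unfolding SD R by (simp add: algebra_simps)
    finally have "(S - R) / of_nat p ^ 2 * of_int (D * (m - 1)) = of_int c"
      unfolding c using p by (simp add: field_simps power2_eq_square)
    then show ?thesis
      using denom_prime_toI [OF assms(1) pE] denom_prime_toI [OF assms(1) False R] by auto
  qed
  ultimately show ?thesis
    unfolding rat_cong_sq_def S_def R_def L_def by blast
qed

end
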